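(* Suppose that $(A,\ast,\alpha)$ is a Hom-Novikov superalgebra over a field $\mathbf{F}$ such that $H^2_\alpha(A,A)=0$. Then $(A,\ast,\alpha)$ is analytically rigid.
   Context: $\mathbf{F}$ is an arbitrary field. All graded spaces are $\mathbb{Z}_2$-graded, $A=A_{\bar 0}\oplus A_{\bar 1}$, $|x|$ is the degree of a homogeneous element $x$, and identities involving signs are for homogeneous elements. Hom-Novikov superalgebra: a triple $(A,\ast,\alpha)$, where $A$ is a $\mathbb{Z}_2$-graded vector space, $\ast$ is an even bilinear product (degrees add) and $\alpha:A\to A$ is an even (degree-preserving) linear map, such that for all homogeneous $x,y,z$: (1) $\alpha(x\ast y)=\alpha(x)\ast\alpha(y)$; (2) $(x\ast y)\ast\alpha(z)-\alpha(x)\ast(y\ast z)=(-1)^{|x||y|}\big((y\ast x)\ast\alpha(z)-\alpha(y)\ast(x\ast z)\big)$; (3) $(x\ast y)\ast\alpha(z)=(-1)^{|y||z|}(x\ast z)\ast\alpha(y)$. Cohomology: $C^n_\alpha(A,A)$ ($n\ge1$) is the space of $n$-linear maps $f:A\times\cdots\times A\to A$ with $\alpha(f(x_1,\dots,x_n))=f(\alpha(x_1),\dots,\alpha(x_n))$; $f$ is homogeneous of degree $|f|\in\mathbb{Z}_2$ if $f(A_{i_1},\dots,A_{i_n})\subseteq A_{i_1+\cdots+i_n+|f|}$. The operators $\delta^n_{hom}:C^n_\alpha(A,A)\to C^{n+1}_\alpha(A,A)$, $n=1,2$, are given on homogeneous $f$ and arguments (and extended linearly) by $$\delta^1_{hom}f(x_1,x_2)=(-1)^{|x_1||f|}x_1\ast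 f(x_2)+f(x_1)\ast x_2-f(x_1\ast x_2),$$ $$\begin{aligned}\delta^2_{hom}f(x_1,x_2,x_3)={}&f(\alpha(x_1),x_2\ast x_3)-(-1)^{|x_1||x_2|}f(\alpha(x_2),x_1\ast x_3)+(-1)^{|x_1||x_2|}f(x_2\ast x_1,\alpha(x_3))\\&+(-1)^{|x_1||f|}\alpha(x_1)\ast f(x_2,x_3)-(-1)^{|x_1||x_2|+|x_2||f|}\alpha(x_2)\ast f(x_1,x_3)\\&+(-1)^{|x_1||x_2|}f(x_2,x_1)\ast\alpha(x_3)-(-1)^{|x_2||x_3|}f(x_1\ast x_3,\alpha(x_2))-(-1)^{|x_2||x_3|}f(x_1,x_3)\ast\alpha(x_2).\end{aligned}$$ They satisfy $\delta^2_{hom}\delta^1_{hom}=0$. Put $Z^2_\alpha(A,A)=\ker\delta^2_{hom}$, $B^2_\alpha(A,A)=\delta^1_{hom}C^1_\alpha(A,A)$, $H^2_\alpha(A,A)=Z^2_\alpha(A,A)/B^2_\alpha(A,A)$. Deformations: $A[[t]]$ is the $\mathbf{F}[[t]]$-module of formal power series over $A$; $\mathbf{F}$-(bi)linear maps on $A$ are extended to be $\mathbf{F}[[t]]$-(bi)linear on $A[[t]]$ coefficientwise. A 1-parameter formal deformation of $(A,\ast,\alpha)$ is a formal power series $g_t(x,y)=\sum_{i\ge0}G_i(x,y)t^i:A[[t]]\times A[[t]]\to A[[t]]$, where each $G_i:A\times A\to A$ is an even $\mathbf{F}$-bilinear map, $G_0(x,y)=x\ast y$, such that $g_t(\alpha(x),\alpha(y))=\alpha(g_t(x,y))$;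 $g_t(\alpha(x),g_t(y,z))-g_t(g_t(x,y),\alpha(z))=(-1)^{|x||y|}\{g_t(\alpha(y),g_t(x,z))-g_t(g_t(y,x),\alpha(z))\}$; and $g_t(g_t(x,y),\alpha(z))=(-1)^{|y||z|}g_t(g_t(x,z),\alpha(y))$. Two 1-parameter formal deformations $g_t,g_t'$ are equivalent, $g_t\sim g_t'$, if there is a formal isomorphism of $\mathbf{F}[[t]]$-modules $\phi_t=\sum_{i\ge0}\phi_it^i:A[[t]]\to A[[t]]$, with each $\phi_i:A\to A$ an $\mathbf{F}$-linear map and $\phi_0=\mathrm{id}_A$, satisfying $\phi_t\circ\alpha=\alpha\circ\phi_t$ and $\phi_t(g_t(x,y))=g_t'(\phi_t(x),\phi_t(y))$. A deformation $g_t$ is trivial if $g_t\sim G_0$ (the null deformation, with $G_1=G_2=\cdots=0$). $(A,\ast,\alpha)$ is analytically rigid if every 1-parameter formal deformation of it is trivial. *)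

theory Defs
  imports
    "HOL-Library.Z2"
    "HOL-Computational_Algebra.Formal_Power_Series"
begin

section \<open>Hom-Novikov superalgebras\<close>

text \<open>
  Degrees are elements of the two-element field \<^typ>\<open>bit\<close>.
  \<open>sg i v\<close> stands for \<open>(-1)\<^sup>i v\<close>; the exponents that occur are sums of products of degrees,
  computed in \<^typ>\<open>bit\<close>.
\<close>

definition sg :: "bit \<Rightarrow> 'a::ab_group_add \<Rightarrow> 'a"
  where "sg i v = (if i = 0 then v else - v)"

definition Z2_graded :: "('f::field \<Rightarrow> 'a::ab_group_add \<Rightarrow> 'a) \<Rightarrow> (bit \<Rightarrow> 'a set) \<Rightarrow> bool"
  where "Z2_graded scale A \<longleftrightarrow>
    (\<forall>i. module.subspace scale (A i)) \<and> A 0 \<inter> A 1 = {0} \<and>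
    (\<forall>x. \<exists>a\<in>A 0. \<exists>b\<in>A 1. x = a + b)"

definition bilin :: "('f::field \<Rightarrow> 'a::ab_group_add \<Rightarrow> 'a) \<Rightarrow> ('a \<Rightarrow> 'a \<Rightarrow> 'a) \<Rightarrow> bool"
  where "bilin scale f \<longleftrightarrow>
    (\<forall>x. Vector_Spaces.linear scale scale (\<lambda>y. f x y)) \<and>
    (\<forall>y. Vector_Spaces.linear scale scale (\<lambda>x. f x y))"

definition even_map :: "(bit \<Rightarrow> 'a set) \<Rightarrow> ('a \<Rightarrow> 'a) \<Rightarrow> bool"
  where "even_map A f \<longleftrightarrow> (\<forall>i. \<forall>x\<in>A i. f x \<in> A i)"

definition even_map2 :: "(bit \<Rightarrow> 'a set) \<Rightarrow> ('a \<Rightarrow> 'a \<Rightarrow> 'a) \<Rightarrow> bool"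
  where "even_map2 A f \<longleftrightarrow> (\<forall>i j. \<forall>x\<in>A i. \<forall>y\<in>A j. f x y \<in> A (i + j))"

text \<open>The underlying vector space is the whole type \<^typ>\<open>'a\<close>, with scalar multiplication \<open>scale\<close>.\<close>

locale hom_novikov_superalgebra = vector_space scale
  for scale :: "'f::field \<Rightarrow> 'a::ab_group_add \<Rightarrow> 'a" +
  fixes A :: "bit \<Rightarrow> 'a set" and mul :: "'a \<Rightarrow> 'a \<Rightarrow> 'a" and alpha :: "'a \<Rightarrow> 'a"
  assumes graded: "Z2_graded scale A"
    and mul_bilin: "bilin scale mul"
    and mul_even: "even_map2 A mul"
    and alpha_linear: "Vector_Spaces.linear scale scale alpha"
    and alpha_even: "even_map A alpha"
    and multiplicative:
      "\<And>i j x y. x \<in> A i \<Longrightarrow> y \<in> A j \<Longrightarrow> alpha (mul x y) = mul (alpha x) (alpha y)"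
    and left_symmetric:
      "\<And>i j k x y z. x \<in> A i \<Longrightarrow> y \<in> A j \<Longrightarrow> z \<in> A k \<Longrightarrow>
        mul (mul x y) (alpha z) - mul (alpha x) (mul y z) =
        sg (i * j) (mul (mul y x) (alpha z) - mul (alpha y) (mul x z))"
    and right_commutative:
      "\<And>i j k x y z. x \<in> A i \<Longrightarrow> y \<in> A j \<Longrightarrow> z \<in> A k \<Longrightarrow>
        mul (mul x y) (alpha z) = sg (j * k) (mul (mul x z) (alpha y))"


section \<open>Cohomology\<close>

text \<open>The component of degree \<open>i\<close> of an element (note \<open>i + 1 \<noteq> i\<close> in \<^typ>\<open>bit\<close>).\<close>

definition gcomp :: "(bit \<Rightarrow> 'a::ab_group_add set) \<Rightarrow> bit \<Rightarrow> 'a \<Rightarrow> 'a"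
  where "gcomp A i x = (THE y. y \<in> A i \<and> x - y \<in> A (i + 1))"

text \<open>The components of degree \<open>d\<close> of a linear and of a bilinear map.\<close>

definition hcomp1 :: "(bit \<Rightarrow> 'a::ab_group_add set) \<Rightarrow> bit \<Rightarrow> ('a \<Rightarrow> 'a) \<Rightarrow> 'a \<Rightarrow> 'a"
  where "hcomp1 A d f x = (\<Sum>i\<in>{0,1}. gcomp A (i + d) (f (gcomp A i x)))"

definition hcomp2 :: "(bit \<Rightarrow> 'a::ab_group_add set) \<Rightarrow> bit \<Rightarrow> ('a \<Rightarrow> 'a \<Rightarrow> 'a) \<Rightarrow> 'a \<Rightarrow> 'a \<Rightarrow> 'a"
  where "hcomp2 A d f x y =
    (\<Sum>i\<in>{0,1}. \<Sum>j\<in>{0,1}. gcomp A (i + j + d) (f (gcomp A i x) (gcomp A j y)))"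

definition C1 :: "('f::field \<Rightarrow> 'a::ab_group_add \<Rightarrow> 'a) \<Rightarrow> ('a \<Rightarrow> 'a) \<Rightarrow> ('a \<Rightarrow> 'a) set"
  where "C1 scale alpha =
    {f. Vector_Spaces.linear scale scale f \<and> (\<forall>x. alpha (f x) = f (alpha x))}"

definition C2 :: "('f::field \<Rightarrow> 'a::ab_group_add \<Rightarrow> 'a) \<Rightarrow> ('a \<Rightarrow> 'a) \<Rightarrow> ('a \<Rightarrow> 'a \<Rightarrow> 'a) set"
  where "C2 scale alpha =
    {f. bilin scale f \<and> (\<forall>x y. alpha (f x y) = f (alpha x) (alpha y))}"

text \<open>
  The coboundary formulas for \<open>f\<close> homogeneous of degree \<open>d\<close> and arguments \<open>x1\<close>, \<open>x2\<close>, \<open>x3\<close>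
  homogeneous of degrees \<open>i1\<close>, \<open>i2\<close>, \<open>i3\<close>.
\<close>

definition delta1_hom ::
    "('a::ab_group_add \<Rightarrow> 'a \<Rightarrow> 'a) \<Rightarrow> bit \<Rightarrow> ('a \<Rightarrow> 'a) \<Rightarrow> bit \<Rightarrow> 'a \<Rightarrow> 'a \<Rightarrow> 'a"
  where "delta1_hom mul d f i1 x1 x2 =
    sg (i1 * d) (mul x1 (f x2)) + mul (f x1) x2 - f (mul x1 x2)"

definition delta2_hom ::
    "('a::ab_group_add \<Rightarrow> 'a \<Rightarrow> 'a) \<Rightarrow> ('a \<Rightarrow> 'a) \<Rightarrow> bit \<Rightarrow> ('a \<Rightarrow> 'a \<Rightarrow> 'a) \<Rightarrow>
     bit \<Rightarrow> bit \<Rightarrow> bit \<Rightarrow> 'a \<Rightarrow> 'a \<Rightarrow> 'a \<Rightarrow> 'a"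
  where "delta2_hom mul alpha d f i1 i2 i3 x1 x2 x3 =
      f (alpha x1) (mul x2 x3)
    - sg (i1 * i2) (f (alpha x2) (mul x1 x3))
    + sg (i1 * i2) (f (mul x2 x1) (alpha x3))
    + sg (i1 * d) (mul (alpha x1) (f x2 x3))
    - sg (i1 * i2 + i2 * d) (mul (alpha x2) (f x1 x3))
    + sg (i1 * i2) (mul (f x2 x1) (alpha x3))
    - sg (i2 * i3) (f (mul x1 x3) (alpha x2))
    - sg (i2 * i3) (mul (f x1 x3) (alpha x2))"

text \<open>Their (multi)linear extension to arbitrary cochains and arguments.\<close>

definition delta1 ::
    "(bit \<Rightarrow> 'a::ab_group_add set) \<Rightarrow> ('a \<Rightarrow> 'a \<Rightarrow> 'a) \<Rightarrow> ('a \<Rightarrow> 'a) \<Rightarrow> 'a \<Rightarrow> 'a \<Rightarrow> 'a"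
  where "delta1 A mul f x1 x2 =
    (\<Sum>d\<in>{0,1}. \<Sum>i1\<in>{0,1}. \<Sum>i2\<in>{0,1}.
      delta1_hom mul d (hcomp1 A d f) i1 (gcomp A i1 x1) (gcomp A i2 x2))"

definition delta2 ::
    "(bit \<Rightarrow> 'a::ab_group_add set) \<Rightarrow> ('a \<Rightarrow> 'a \<Rightarrow> 'a) \<Rightarrow> ('a \<Rightarrow> 'a) \<Rightarrow> ('a \<Rightarrow> 'a \<Rightarrow> 'a) \<Rightarrow>
     'a \<Rightarrow> 'a \<Rightarrow> 'a \<Rightarrow> 'a"
  where "delta2 A mul alpha f x1 x2 x3 =
    (\<Sum>d\<in>{0,1}. \<Sum>i1\<in>{0,1}. \<Sum>i2\<in>{0,1}. \<Sum>i3\<in>{0,1}.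
      delta2_hom mul alpha d (hcomp2 A d f) i1 i2 i3
        (gcomp A i1 x1) (gcomp A i2 x2) (gcomp A i3 x3))"

definition Z2_cocycles ::
    "('f::field \<Rightarrow> 'a::ab_group_add \<Rightarrow> 'a) \<Rightarrow> (bit \<Rightarrow> 'a set) \<Rightarrow> ('a \<Rightarrow> 'a \<Rightarrow> 'a) \<Rightarrow> ('a \<Rightarrow> 'a) \<Rightarrow>
     ('a \<Rightarrow> 'a \<Rightarrow> 'a) set"
  where "Z2_cocycles scale A mul alpha =
    {f \<in> C2 scale alpha. delta2 A mul alpha f = (\<lambda>x1 x2 x3. 0)}"

definition B2_coboundaries ::
    "('f::field \<Rightarrow> 'a::ab_group_add \<Rightarrow> 'a) \<Rightarrow> (bit \<Rightarrow> 'a set) \<Rightarrow> ('a \<Rightarrow> 'a \<Rightarrow> 'a) \<Rightarrow> ('a \<Rightarrow> 'a) \<Rightarrow>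
     ('a \<Rightarrow> 'a \<Rightarrow> 'a) set"
  where "B2_coboundaries scale A mul alpha = delta1 A mul ` C1 scale alpha"

text \<open>
  The quotient is the set of cosets of \<open>B\<^sup>2\<close> in \<open>Z\<^sup>2\<close>. Its zero element is the coset \<open>B\<^sup>2\<close>
  (see \<open>B2_subset_Z2\<close> below), so \<open>H\<^sup>2 = 0\<close> reads \<open>H2_cohomology \<dots> = {B2_coboundaries \<dots>}\<close>.
\<close>

definition H2_cohomology ::
    "('f::field \<Rightarrow> 'a::ab_group_add \<Rightarrow> 'a) \<Rightarrow> (bit \<Rightarrow> 'a set) \<Rightarrow> ('a \<Rightarrow> 'a \<Rightarrow> 'a) \<Rightarrow> ('a \<Rightarrow> 'a) \<Rightarrow>
     ('a \<Rightarrow> 'a \<Rightarrow> 'a) set set"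
  where "H2_cohomology scale A mul alpha =
    Z2_cocycles scale A mul alpha //
      {(f, g). f \<in> Z2_cocycles scale A mul alpha \<and> g \<in> Z2_cocycles scale A mul alpha \<and>
        (\<lambda>x y. f x y - g x y) \<in> B2_coboundaries scale A mul alpha}"


section \<open>Formal deformations\<close>

text \<open>
  \<open>A[[t]]\<close> is the type \<^typ>\<open>'a fps\<close>, with the following action of the ring \<^typ>\<open>'f fps\<close>.
\<close>

definition fps_scale ::
    "('f::field \<Rightarrow> 'a::ab_group_add \<Rightarrow> 'a) \<Rightarrow> 'f fps \<Rightarrow> 'a fps \<Rightarrow> 'a fps"
  where "fps_scale scale c v =
    Abs_fps (\<lambda>n. \<Sum>i\<le>n. scale (fps_nth c i) (fps_nth v (n - i)))"

definition fps_graded :: "(bit \<Rightarrow> 'a set) \<Rightarrow> bit \<Rightarrow> 'a fps set"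
  where "fps_graded A i = {x. \<forall>n. fps_nth x n \<in> A i}"

definition ext_const :: "('a \<Rightarrow> 'a) \<Rightarrow> 'a fps \<Rightarrow> 'a fps"
  where "ext_const f x = Abs_fps (\<lambda>n. f (fps_nth x n))"

text \<open>The maps \<open>\<phi>\<^sub>t = \<Sum>\<^sub>i \<phi>\<^sub>i t\<^sup>i\<close> and \<open>g\<^sub>t = \<Sum>\<^sub>i G\<^sub>i t\<^sup>i\<close> on \<open>A[[t]]\<close>.\<close>

definition ext1 :: "(nat \<Rightarrow> 'a::ab_group_add \<Rightarrow> 'a) \<Rightarrow> 'a fps \<Rightarrow> 'a fps"
  where "ext1 \<phi> x = Abs_fps (\<lambda>n. \<Sum>i\<le>n. \<phi> i (fps_nth x (n - i)))"

definition ext2 :: "(nat \<Rightarrow> 'a::ab_group_add \<Rightarrow> 'a \<Rightarrow> 'a) \<Rightarrow> 'a fps \<Rightarrow> 'a fps \<Rightarrow> 'a fps"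
  where "ext2 G x y = Abs_fps (\<lambda>n. \<Sum>i\<le>n. \<Sum>j\<le>n - i.
    G i (fps_nth x j) (fps_nth y (n - i - j)))"

definition formal_deformation ::
    "('f::field \<Rightarrow> 'a::ab_group_add \<Rightarrow> 'a) \<Rightarrow> (bit \<Rightarrow> 'a set) \<Rightarrow> ('a \<Rightarrow> 'a \<Rightarrow> 'a) \<Rightarrow> ('a \<Rightarrow> 'a) \<Rightarrow>
     (nat \<Rightarrow> 'a \<Rightarrow> 'a \<Rightarrow> 'a) \<Rightarrow> bool"
  where "formal_deformation scale A mul alpha G \<longleftrightarrow>
    (\<forall>n. bilin scale (G n) \<and> even_map2 A (G n)) \<and>
    G 0 = mul \<and>
    (let g = ext2 G; a = ext_const alpha in
      (\<forall>x y. g (a x) (a y) = a (g x y)) \<and>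
      (\<forall>i j k. \<forall>x\<in>fps_graded A i. \<forall>y\<in>fps_graded A j. \<forall>z\<in>fps_graded A k.
        g (a x) (g y z) - g (g x y) (a z) =
          sg (i * j) (g (a y) (g x z) - g (g y x) (a z)) \<and>
        g (g x y) (a z) = sg (j * k) (g (g x z) (a y))))"

definition equivalent_deformations ::
    "('f::field \<Rightarrow> 'a::ab_group_add \<Rightarrow> 'a) \<Rightarrow> ('a \<Rightarrow> 'a) \<Rightarrow>
     (nat \<Rightarrow> 'a \<Rightarrow> 'a \<Rightarrow> 'a) \<Rightarrow> (nat \<Rightarrow> 'a \<Rightarrow> 'a \<Rightarrow> 'a) \<Rightarrow> bool"
  where "equivalent_deformations scale alpha G G' \<longleftrightarrow>
    (\<exists>\<phi>. (\<forall>n. Vector_Spaces.linear scale scale (\<phi> n)) \<and> \<phi> 0 = id \<and>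
      module_hom (fps_scale scale) (fps_scale scale) (ext1 \<phi>) \<and> bij (ext1 \<phi>) \<and>
      ext1 \<phi> \<circ> ext_const alpha = ext_const alpha \<circ> ext1 \<phi> \<and>
      (\<forall>x y. ext1 \<phi> (ext2 G x y) = ext2 G' (ext1 \<phi> x) (ext1 \<phi> y)))"

definition null_deformation :: "('a::ab_group_add \<Rightarrow> 'a \<Rightarrow> 'a) \<Rightarrow> nat \<Rightarrow> 'a \<Rightarrow> 'a \<Rightarrow> 'a"
  where "null_deformation mul n = (if n = 0 then mul else (\<lambda>x y. 0))"

definition trivial_deformation ::
    "('f::field \<Rightarrow> 'a::ab_group_add \<Rightarrow> 'a) \<Rightarrow> ('a \<Rightarrow> 'a \<Rightarrow> 'a) \<Rightarrow> ('a \<Rightarrow> 'a) \<Rightarrow>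
     (nat \<Rightarrow> 'a \<Rightarrow> 'a \<Rightarrow> 'a) \<Rightarrow> bool"
  where "trivial_deformation scale mul alpha G \<longleftrightarrow>
    equivalent_deformations scale alpha G (null_deformation mul)"

definition analytically_rigid ::
    "('f::field \<Rightarrow> 'a::ab_group_add \<Rightarrow> 'a) \<Rightarrow> (bit \<Rightarrow> 'a set) \<Rightarrow> ('a \<Rightarrow> 'a \<Rightarrow> 'a) \<Rightarrow> ('a \<Rightarrow> 'a) \<Rightarrow> bool"
  where "analytically_rigid scale A mul alpha \<longleftrightarrow>
    (\<forall>G. formal_deformation scale A mul alpha G \<longrightarrow> trivial_deformation scale mul alpha G)"


section \<open>Basic properties\<close>

text \<open>
  The main facts are \<open>delta1_homog\<close> and \<open>delta2_homog\<close> (the extended coboundary operators restrict to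
  the given formulas on homogeneous cochains and arguments), \<open>B2_subset_Z2\<close>, and that \<open>A[[t]]\<close> is a
  module over the formal power series ring, on which \<open>ext1 \<phi>\<close> acts as a module homomorphism.
\<close>

lemma sg_0 [simp]: "sg i 0 = 0" by (simp add: sg_def)

lemma bit_ne [simp]: "(i::bit) + 1 \<noteq> i" by (cases i) auto
lemma bit_two [simp]: "(i::bit) + 1 + 1 = i" by (cases i) auto

context hom_novikov_superalgebra
begin

lemma subsp: "subspace (A i)" using graded by (simp add: Z2_graded_def)
lemmas A_closed [simp] = subspace_0[OF subsp] subspace_add[OF subsp] subspace_diff[OF subsp]
  subspace_neg[OF subsp] subspace_scale[OF subsp]

lemma sg_A [simp]: "x \<in> A i \<Longrightarrow> sg j x \<in> A i" by (simp add: sg_def)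

lemma A_disj: "x \<in> A i \<Longrightarrow> x \<in> A (i+1) \<Longrightarrow> x = 0"
  using graded by (cases i) (auto simp: Z2_graded_def)

lemma gcomp_eqI: assumes "y \<in> A i" "x - y \<in> A (i+1)" shows "gcomp A i x = y"
  unfolding gcomp_def
proof (rule the_equality)
  fix z assume z: "z \<in> A i \<and> x - z \<in> A (i+1)"
  have "z - y \<in> A i" using z assms by simp
  moreover have "(x - y) - (x - z) \<in> A (i+1)" using z assms A_closed(3) by blast
  ultimately show "z = y" using A_disj[of "z - y" i] by simp
qed (use assms in simp)

lemma gcomp_ex: "\<exists>y. y \<in> A i \<and> x - y \<in> A (i+1)"
proof -
  obtain a b where "a \<in> A 0" "b \<in> A 1" "x = a + b" using graded unfolding Z2_graded_def by blast
  then show ?thesis by (cases i) (auto intro: exI[of _ a] exI[of _ b])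
qed

lemma gcomp_in [simp]: "gcomp A i x \<in> A i" and gcomp_in': "x - gcomp A i x \<in> A (i+1)"
  using gcomp_ex gcomp_eqI by metis+

lemma gcomp_add: "gcomp A i (x + y) = gcomp A i x + gcomp A i y"
proof (rule gcomp_eqI)
  have "(x - gcomp A i x) + (y - gcomp A i y) \<in> A (i+1)" using gcomp_in' by simp
  then show "x + y - (gcomp A i x + gcomp A i y) \<in> A (i+1)" by (simp add: algebra_simps)
qed simp

lemma gcomp_scale: "gcomp A i (scale c x) = scale c (gcomp A i x)"
  using A_closed(5)[OF gcomp_in'[of x i]] by (intro gcomp_eqI) (simp_all add: scale_right_diff_distrib)

lemma gcomp_hom: "x \<in> A j \<Longrightarrow> gcomp A i x = (if i = j then x else 0)"
  by (cases i; cases j) (auto intro!: gcomp_eqI)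

lemma gcomp_0: "gcomp A i 0 = 0"
  using gcomp_hom[OF A_closed(1)] by simp

lemma gcomp_sum: "gcomp A 0 x + gcomp A 1 x = x"
proof -
  have "x - gcomp A 0 x \<in> A 1" using gcomp_in'[of x 0] by simp
  then have "gcomp A 1 x = x - gcomp A 0 x" by (auto intro!: gcomp_eqI)
  then show ?thesis by simp
qed

abbreviation lin where "lin f \<equiv> Vector_Spaces.linear scale scale f"

lemma linI: "(\<And>x y. f (x+y) = f x + f y) \<Longrightarrow> (\<And>c x. f (scale c x) = scale c (f x)) \<Longrightarrow> lin f"
  by (auto simp: Vector_Spaces.linear_iff vector_space_axioms)

lemma lin_add: "lin f \<Longrightarrow> f (x+y) = f x + f y"
  and lin_scale: "lin f \<Longrightarrow> f (scale c x) = scale c (f x)"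
  by (auto simp: Vector_Spaces.linear_iff)
lemma lin_0: "lin f \<Longrightarrow> f 0 = 0" by (metis lin_add add_cancel_right_left)
lemma lin_neg: "lin f \<Longrightarrow> f (-x) = - f x"
  by (metis lin_add lin_0 add.right_inverse eq_neg_iff_add_eq_0 minus_unique)
lemma lin_diff: "lin f \<Longrightarrow> f (x-y) = f x - f y"
  by (metis lin_add lin_neg diff_conv_add_uminus)
lemmas lin_simps = lin_add lin_scale lin_0 lin_neg lin_diff

lemma mulL: "lin (\<lambda>x. mul x y)" and mulR: "lin (\<lambda>y. mul x y)"
  using mul_bilin by (auto simp: bilin_def)
lemmas msimps = lin_simps[OF mulL] lin_simps[OF mulR] lin_simps[OF alpha_linear]

lemma mul_in [simp]: "x \<in> A i \<Longrightarrow> y \<in> A j \<Longrightarrow> mul x y \<in> A (i+j)"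
  using mul_even by (auto simp: even_map2_def)
lemma alpha_in [simp]: "x \<in> A i \<Longrightarrow> alpha x \<in> A i"
  using alpha_even by (auto simp: even_map_def)

lemma gcomp_alpha: "gcomp A i (alpha x) = alpha (gcomp A i x)"
  using alpha_in[OF gcomp_in'[of x i]] by (intro gcomp_eqI) (simp_all add: msimps)

lemma alpha_mul: "alpha (mul x y) = mul (alpha x) (alpha y)"
proof -
  have "alpha (mul (gcomp A 0 x + gcomp A 1 x) (gcomp A 0 y + gcomp A 1 y))
    = mul (alpha (gcomp A 0 x + gcomp A 1 x)) (alpha (gcomp A 0 y + gcomp A 1 y))"
    by (simp add: msimps multiplicative[OF gcomp_in gcomp_in])
  then show ?thesis by (simp add: gcomp_sum)
qed

text \<open>The combination of the two defining identities whose linearization is \<open>delta2\<close>.\<close>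

definition E where "E i j k x y z = mul (alpha x) (mul y z) - sg (i*j) (mul (alpha y) (mul x z))
  + sg (i*j) (mul (mul y x) (alpha z)) - sg (j*k) (mul (mul x z) (alpha y))"

lemma E0: assumes "x \<in> A i" "y \<in> A j" "z \<in> A k" shows "E i j k x y z = 0"
  using left_symmetric[OF assms] right_commutative[OF assms]
  unfolding E_def by (auto simp: sg_def algebra_simps split: if_splits)

lemma hom_dd:
  assumes x: "x \<in> A i" "y \<in> A j" "z \<in> A k"
    and h: "lin h" "\<And>i x. x \<in> A i \<Longrightarrow> h x \<in> A (i+d)" "\<And>x. h (alpha x) = alpha (h x)"
  shows
   "delta1_hom mul d h i (alpha x) (mul y z)
    - sg (i * j) (delta1_hom mul d h j (alpha y) (mul x z))
    + sg (i * j) (delta1_hom mul d h (j+i) (mul y x) (alpha z))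
    + sg (i * d) (mul (alpha x) (delta1_hom mul d h j y z))
    - sg (i * j + j * d) (mul (alpha y) (delta1_hom mul d h i x z))
    + sg (i * j) (mul (delta1_hom mul d h j y x) (alpha z))
    - sg (j * k) (delta1_hom mul d h (i+k) (mul x z) (alpha y))
    - sg (j * k) (mul (delta1_hom mul d h i x z) (alpha y)) = 0" (is "?L = 0")
proof -
  have "?L = E (i+d) j k (h x) y z + sg (i*d) (E i (j+d) k x (h y) z)
     + sg (i*d+j*d) (E i j (k+d) x y (h z)) - h (E i j k x y z)"
    unfolding delta1_hom_def E_def
    by (cases i; cases j; cases k; cases d)
      (simp_all add: sg_def msimps lin_simps[OF h(1)] h(3) alpha_mul algebra_simps)
  also have "\<dots> = 0"
    using x h(2) by (simp add: E0 lin_simps[OF h(1)])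
  finally show ?thesis .
qed

lemma hcomp1_in: "x \<in> A i \<Longrightarrow> lin f \<Longrightarrow> hcomp1 A d f x \<in> A (i+d)"
  by (cases i) (auto simp: hcomp1_def gcomp_hom lin_0)

lemma hcomp1_lin: "lin f \<Longrightarrow> lin (hcomp1 A d f)"
  by (rule linI) (auto simp: hcomp1_def gcomp_add gcomp_scale lin_simps algebra_simps scale_right_distrib)

lemma hcomp1_alpha: "f \<in> C1 scale alpha \<Longrightarrow> hcomp1 A d f (alpha x) = alpha (hcomp1 A d f x)"
proof -
  assume "f \<in> C1 scale alpha"
  then have "f (alpha x) = alpha (f x)" for x by (simp add: C1_def)
  then show ?thesis by (simp add: hcomp1_def gcomp_alpha msimps)
qed

lemma delta1_hom_lin:
  assumes h: "lin h" shows "lin (\<lambda>x. delta1_hom mul d h i x y)" "lin (\<lambda>y. delta1_hom mul d h i x y)"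
  by (rule linI; simp add: delta1_hom_def sg_def msimps lin_simps[OF h] scale_right_distrib scale_right_diff_distrib)+

lemma delta1_lin:
  assumes f: "lin f" shows "bilin scale (delta1 A mul f)"
  unfolding bilin_def
  apply (intro conjI allI)
   apply (rule linI; simp add: delta1_def gcomp_add gcomp_scale lin_simps[OF delta1_hom_lin(2)[OF hcomp1_lin[OF f]]] scale_right_distrib algebra_simps)
   apply (rule linI; simp add: delta1_def gcomp_add gcomp_scale lin_simps[OF delta1_hom_lin(1)[OF hcomp1_lin[OF f]]] scale_right_distrib algebra_simps)
  done

lemma delta1_C2:
  assumes f: "f \<in> C1 scale alpha" shows "delta1 A mul f \<in> C2 scale alpha"
proof -
  have l: "lin f" using f by (simp add: C1_def)
  have h: "alpha (hcomp1 A d f (mul x y)) = hcomp1 A d f (mul (alpha x) (alpha y))" for d x y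
    by (simp only: alpha_mul[symmetric] hcomp1_alpha[OF f])
  have "alpha (delta1_hom mul d (hcomp1 A d f) i x y)
      = delta1_hom mul d (hcomp1 A d f) i (alpha x) (alpha y)" for d i x y
    by (simp add: delta1_hom_def sg_def msimps h alpha_mul hcomp1_alpha[OF f])
  then show ?thesis
    using delta1_lin[OF l] by (simp add: C2_def delta1_def msimps gcomp_alpha)
qed

lemma delta1_homog:
  assumes "lin f" "\<And>i x. x \<in> A i \<Longrightarrow> f x \<in> A (i+d)" "x \<in> A i" "y \<in> A j"
  shows "delta1 A mul f x y = delta1_hom mul d f i x y"
proof -
  have h: "hcomp1 A e f x = (if e = d then f x else 0)" if "x \<in> A i" for e i x
    using that assms(1,2) by (cases i; cases e; cases d; auto simp: hcomp1_def gcomp_hom lin_0 gcomp_hom[OF assms(2)])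
  then show ?thesis using assms
    apply (cases d; cases i; cases j)
    apply (simp_all add: delta1_def gcomp_hom delta1_hom_def h[OF mul_in] h msimps lin_0 sg_def)
    done
qed

lemma delta1_hom_in:
  assumes h: "\<And>i x. x \<in> A i \<Longrightarrow> h x \<in> A (i+d)" and x: "x \<in> A i" "y \<in> A j"
  shows "delta1_hom mul d h i x y \<in> A (i+j+d)"
proof -
  have "mul x (h y) \<in> A (i+j+d)" using mul_in[OF x(1) h[OF x(2)]] by (simp only: add.assoc)
  moreover have "mul (h x) y \<in> A (i+j+d)" using mul_in[OF h[OF x(1)] x(2)] by (simp only: ac_simps)
  moreover have "h (mul x y) \<in> A (i+j+d)" using h[OF mul_in[OF x]] .
  ultimately show ?thesis unfolding delta1_hom_def by simp
qed

lemma hcomp2_delta1: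
  assumes f: "f \<in> C1 scale alpha" and x: "x \<in> A i" "y \<in> A j"
  shows "hcomp2 A d (delta1 A mul f) x y = delta1_hom mul d (hcomp1 A d f) i x y"
proof -
  have l: "lin f" using f by (simp add: C1_def)
  note l1 = delta1_hom_lin[OF hcomp1_lin[OF l]]
  have e: "delta1 A mul f x y = (\<Sum>d\<in>{0,1}. delta1_hom mul d (hcomp1 A d f) i x y)"
    using x by (cases i; cases j) (simp_all add: delta1_def gcomp_hom lin_0[OF l1(1)] lin_0[OF l1(2)])
  have z: "delta1 A mul f 0 y = 0" "delta1 A mul f x 0 = 0" "delta1 A mul f 0 0 = 0" for x y
    using delta1_lin[OF l] unfolding bilin_def by (metis lin_0)+
  have g: "gcomp A (i+j+d) (delta1_hom mul e (hcomp1 A e f) i x y)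
      = (if d = e then delta1_hom mul e (hcomp1 A e f) i x y else 0)" for e
    using gcomp_hom[OF delta1_hom_in[where h="hcomp1 A e f" and d=e, OF hcomp1_in[OF _ l] x], of "i+j+d"]
    by (simp only: add_left_cancel)
  have "hcomp2 A d (delta1 A mul f) x y = gcomp A (i+j+d) (delta1 A mul f x y)"
    using x by (cases i; cases j) (simp_all add: hcomp2_def gcomp_hom z gcomp_hom[OF A_closed(1)])
  also have "\<dots> = gcomp A (i+j+d) (delta1_hom mul 0 (hcomp1 A 0 f) i x y) 
     + gcomp A (i+j+d) (delta1_hom mul 1 (hcomp1 A 1 f) i x y)" by (simp add: e gcomp_add)
  also have "\<dots> = delta1_hom mul d (hcomp1 A d f) i x y"
    using g[of 0] g[of 1] by (cases d) simp_all
  finally show ?thesis .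
qed

lemma B2_subset_Z2: "B2_coboundaries scale A mul alpha \<subseteq> Z2_cocycles scale A mul alpha"
proof -
  have "delta2 A mul alpha (delta1 A mul f) x y z = 0" if f: "f \<in> C1 scale alpha" for f x y z
  proof -
    have l: "lin f" using f by (simp add: C1_def)
    have "delta2_hom mul alpha d (hcomp2 A d (delta1 A mul f)) i j k x y z = 0"
      if x: "x \<in> A i" "y \<in> A j" "z \<in> A k" for d i j k x y z
      unfolding delta2_hom_def
      using hom_dd[OF x hcomp1_lin[OF l] hcomp1_in[OF _ l] hcomp1_alpha[OF f], of d]
      by (simp only: hcomp2_delta1[OF f] x alpha_in[OF x(1)] alpha_in[OF x(2)] alpha_in[OF x(3)]
         hcomp2_delta1[OF f x(1) x(2)] hcomp2_delta1[OF f x(1) x(3)] hcomp2_delta1[OF f x(2) x(3)]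
         hcomp2_delta1[OF f x(2) x(1)]
         hcomp2_delta1[OF f alpha_in[OF x(1)] mul_in[OF x(2) x(3)]]
         hcomp2_delta1[OF f alpha_in[OF x(2)] mul_in[OF x(1) x(3)]]
         hcomp2_delta1[OF f mul_in[OF x(2) x(1)] alpha_in[OF x(3)]]
         hcomp2_delta1[OF f mul_in[OF x(1) x(3)] alpha_in[OF x(2)]])
    then show ?thesis by (simp add: delta2_def)
  qed
  then show ?thesis using delta1_C2 by (auto simp: B2_coboundaries_def Z2_cocycles_def fun_eq_iff)
qed

lemma module_fps_scale: "module (fps_scale scale)"
proof
  fix a b :: "'a fps" and c d :: "'f fps"
  show "fps_scale scale c (a + b) = fps_scale scale c a + fps_scale scale c b"
    by (simp add: fps_scale_def fps_eq_iff scale_right_distrib sum.distrib)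
  show "fps_scale scale (c + d) a = fps_scale scale c a + fps_scale scale d a"
    by (simp add: fps_scale_def fps_eq_iff scale_left_distrib sum.distrib)
  show "fps_scale scale 1 a = a"
    by (simp add: fps_scale_def fps_eq_iff if_distrib[of "\<lambda>c. scale c _"] sum.delta cong: if_cong)
  show "fps_scale scale c (fps_scale scale d a) = fps_scale scale (c * d) a"
  proof (rule fps_ext)
    fix n
    show "fps_nth (fps_scale scale c (fps_scale scale d a)) n = fps_nth (fps_scale scale (c * d) a) n"
      using fps_mult_assoc_lemma[where k=n and f="\<lambda>i j k. scale (fps_nth c i * fps_nth d j) (fps_nth a k)"]
      by (simp add: fps_scale_def fps_mult_nth scale_sum_right scale_sum_left atLeast0AtMost)
  qed
qed

lemma module_hom_ext1:
  assumes "\<And>n. lin (\<phi> n)" shows "module_hom (fps_scale scale) (fps_scale scale) (ext1 \<phi>)"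
proof -
  have s: "\<phi> n (sum g S) = (\<Sum>x\<in>S. \<phi> n (g x))" for n and g :: "nat \<Rightarrow> _" and S
    by (induction S rule: infinite_finite_induct) (simp_all add: lin_simps[OF assms])
  have "ext1 \<phi> (fps_scale scale c x) = fps_scale scale c (ext1 \<phi> x)" for c x
  proof (rule fps_ext)
    fix n
    have "fps_nth (ext1 \<phi> (fps_scale scale c x)) n =
      (\<Sum>i\<le>n. \<Sum>j\<le>n-i. scale (fps_nth c j) (\<phi> i (fps_nth x (n-i-j))))"
      by (simp add: ext1_def fps_scale_def s lin_simps[OF assms])
    also have "\<dots> = (\<Sum>(i,j) | i + j \<le> n. scale (fps_nth c j) (\<phi> i (fps_nth x (n-i-j))))"
      by (subst sum.Sigma) (auto intro!: sum.cong)
    also have "\<dots> = (\<Sum>(j,i) | j + i \<le> n. scale (fps_nth c j) (\<phi> i (fps_nth x (n-j-i))))"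
      by (rule sum.reindex_bij_witness[of _ prod.swap prod.swap]) (auto simp: diff_commute add.commute)
    also have "\<dots> = (\<Sum>j\<le>n. \<Sum>i\<le>n-j. scale (fps_nth c j) (\<phi> i (fps_nth x (n-j-i))))"
      by (subst sum.Sigma) (auto intro!: sum.cong)
    also have "\<dots> = fps_nth (fps_scale scale c (ext1 \<phi> x)) n"
      by (simp add: ext1_def fps_scale_def scale_sum_right)
    finally show "fps_nth (ext1 \<phi> (fps_scale scale c x)) n = fps_nth (fps_scale scale c (ext1 \<phi> x)) n" .
  qed
  then show ?thesis using module_fps_scale
    by (auto simp: module_hom_iff ext1_def lin_simps[OF assms] fps_eq_iff sum.distrib)
qed

lemma delta2_homog:
  assumes "bilin scale f" "\<And>i j x y. x \<in> A i \<Longrightarrow> y \<in> A j \<Longrightarrow> f x y \<in> A (i+j+d)"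
    "x \<in> A i" "y \<in> A j" "z \<in> A k"
  shows "delta2 A mul alpha f x y z = delta2_hom mul alpha d f i j k x y z"
proof -
  have f0: "f 0 x = 0" "f x 0 = 0" "f 0 0 = 0" for x using assms(1) unfolding bilin_def by (metis lin_0)+
  have h: "hcomp2 A e f x y = (if e = d then f x y else 0)" if xy: "x \<in> A i" "y \<in> A j" for e i j x y
  proof -
    have "hcomp2 A e f x y = gcomp A (i+j+e) (f x y)"
      using xy by (cases i; cases j) (simp_all add: hcomp2_def gcomp_hom f0 gcomp_hom[OF A_closed(1)])
    then show ?thesis using gcomp_hom[OF assms(2)[OF xy], of "i+j+e"] by (simp only: add_left_cancel)
  qed
  have z: "delta2_hom mul alpha e f i j k 0 y z = 0" "delta2_hom mul alpha e f i j k x 0 z = 0"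
     "delta2_hom mul alpha e f i j k x y 0 = 0" if "\<And>x. f 0 x = 0" "\<And>x. f x 0 = 0" for e f i j k x y z
    by (simp_all add: delta2_hom_def msimps that)
  have z0: "hcomp2 A e f 0 y = 0" "hcomp2 A e f x 0 = 0" for e x y
    by (simp_all add: hcomp2_def gcomp_0 f0)
  note z = z[where f="hcomp2 A e f" for e, OF z0]
  have e: "delta2 A mul alpha f x y z = (\<Sum>e\<in>{0,1}. delta2_hom mul alpha e (hcomp2 A e f) i j k x y z)"
    unfolding delta2_def using assms(3-5)
    by (cases i; cases j; cases k) (simp_all add: gcomp_hom z)
  have "delta2_hom mul alpha e (hcomp2 A e f) i j k x y z =
     (if e = d then delta2_hom mul alpha d f i j k x y z else 0)" for e
    unfolding delta2_hom_def
    using assms(3-5) h[OF alpha_in[OF assms(3)] mul_in[OF assms(4) assms(5)]]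
      h[OF alpha_in[OF assms(4)] mul_in[OF assms(3) assms(5)]]
      h[OF mul_in[OF assms(4) assms(3)] alpha_in[OF assms(5)]]
      h[OF mul_in[OF assms(3) assms(5)] alpha_in[OF assms(4)]]
    by (simp only: h[OF assms(4) assms(5)] h[OF assms(3) assms(5)] h[OF assms(4) assms(3)]) (simp add: msimps)
  then show ?thesis unfolding e by (cases d) simp_all
qed

end

end

theory Submission
  imports Defs
begin

text \<open>
  The coefficients of \<open>\<Phi> = \<Sum>\<^sub>i \<phi>\<^sub>i t\<^sup>i\<close> are chosen one after the other. Suppose that the
  truncation \<open>\<Phi>\<close> at order \<open>n\<close> is even, commutes with \<open>\<alpha>\<close>, and satisfies
  \<open>\<Phi>(g(x,y)) = \<Phi>(x) * \<Phi>(y) + c(x,y) t\<^sup>n + \<dots>\<close>. Apply \<open>\<Phi>\<close> to the combination of the two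
  deformation identities whose linearization is \<open>\<delta>\<^sup>2\<close>, and subtract the same combination for \<open>*\<close>
  at \<open>\<Phi>(x), \<Phi>(y), \<Phi>(z)\<close>: the coefficient of \<open>t\<^sup>n\<close> is \<open>\<delta>\<^sup>2 c(x,y,z)\<close>, so \<open>c\<close> is a cocycle. Hence
  \<open>c = \<delta>\<^sup>1 f\<close>, and since \<open>c\<close> is even, the even part of \<open>f\<close> can be taken as \<open>\<phi>\<^sub>n\<close>.
\<close>

section \<open>Reindexing coefficient sums of products of power series\<close>

definition triples :: "nat \<Rightarrow> (nat \<times> nat \<times> nat) set"
  where "triples n = {(i, j, k). i + j + k = n}"

text \<open>This family and \<open>product_coeffs\<close> are the coefficients of
  \<open>\<Phi>(g(x,y))\<close> and \<open>\<Phi>(x) * \<Phi>(y)\<close> for x, y in A. Both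
  composites on \<open>A[[t]]\<close> thereby become \<open>ext2\<close> of a family of maps on
  A.\<close>

definition compose_coeffs ::
    "(nat \<Rightarrow> 'a::ab_group_add \<Rightarrow> 'a) \<Rightarrow> (nat \<Rightarrow> 'a \<Rightarrow> 'a \<Rightarrow> 'a) \<Rightarrow> nat \<Rightarrow> 'a \<Rightarrow> 'a \<Rightarrow> 'a"
  where "compose_coeffs \<phi> G n x y = (\<Sum>i\<le>n. \<phi> i (G (n - i) x y))"

definition product_coeffs ::
    "('a::ab_group_add \<Rightarrow> 'a \<Rightarrow> 'a) \<Rightarrow> (nat \<Rightarrow> 'a \<Rightarrow> 'a) \<Rightarrow> nat \<Rightarrow> 'a \<Rightarrow> 'a \<Rightarrow> 'a"
  where "product_coeffs mul \<phi> n x y = (\<Sum>i\<le>n. mul (\<phi> i x) (\<phi> (n - i) y))"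

text \<open>The right and left versions match the two bracketings: x * (y * z) splits off the first
  index first, (x * y) * z the sum of the first two. Passing through \<open>triples\<close> makes
  them comparable.\<close>

lemma sum_triples_right:
  "(\<Sum>i\<le>n. \<Sum>j\<le>n - i. f i j (n - i - j)) = (\<Sum>(i, j, k)\<in>triples n. f i j k)"
  by (subst sum.Sigma) (auto simp: triples_def
    intro!: sum.reindex_bij_witness[of _ "\<lambda>(i, j, k). (i, j)" "\<lambda>(i, j). (i, j, n - i - j)"])

lemma sum_triples_left:
  "(\<Sum>p\<le>n. \<Sum>i\<le>p. f i (p - i) (n - p)) = (\<Sum>(i, j, k)\<in>triples n. f i j k)"
  by (subst sum.Sigma) (auto simp: triples_def
    intro!: sum.reindex_bij_witness[of _ "\<lambda>(i, j, k). (i + j, i)" "\<lambda>(p, i). (i, p - i, n - p)"])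

lemma sum_triples_swap12:
  "(\<Sum>(i, j, k)\<in>triples n. f j i k) = (\<Sum>(i, j, k)\<in>triples n. f i j k)"
  by (rule sum.reindex_bij_witness[of _ "\<lambda>(i, j, k). (j, i, k)" "\<lambda>(i, j, k). (j, i, k)"])
    (auto simp: triples_def)

lemma sum_triples_swap23:
  "(\<Sum>(i, j, k)\<in>triples n. f i k j) = (\<Sum>(i, j, k)\<in>triples n. f i j k)"
  by (rule sum.reindex_bij_witness[of _ "\<lambda>(i, j, k). (i, k, j)" "\<lambda>(i, j, k). (i, k, j)"])
    (auto simp: triples_def)

lemma sg_sum: "sg i (sum f S) = (\<Sum>x\<in>S. sg i (f x))"
  by (simp add: sg_def sum_negf)

lemma sg_fps_nth: "fps_nth (sg i x) n = sg i (fps_nth x n)"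
  by (simp add: sg_def)

lemma ext2_const_nth:
  assumes "\<And>i y. G i 0 y = 0" "\<And>i x. G i x 0 = 0"
  shows "fps_nth (ext2 G (fps_const x) (fps_const y)) n = G n x y"
proof -
  have "fps_nth (ext2 G (fps_const x) (fps_const y)) n
    = (\<Sum>i\<le>n. \<Sum>j\<le>n - i. if j = 0 \<and> i = n then G n x y else 0)"
    unfolding ext2_def by (auto simp: assms intro!: sum.cong)
  also have "\<dots> = (\<Sum>i\<le>n. if i = n then G n x y else 0)"
    by (intro sum.cong) auto
  finally show ?thesis by simp
qed

text \<open>If the family starts in order n, then in order n the map uses up the whole order and
  leaves only the constant terms of the arguments.\<close>

lemma ext2_lowest:
  assumes "\<And>i x y. i < n \<Longrightarrow> H i x y = 0"
  shows "m < n \<Longrightarrow> fps_nth (ext2 H u v) m = 0"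
    and "fps_nth (ext2 H u v) n = H n (fps_nth u 0) (fps_nth v 0)"
proof -
  show "fps_nth (ext2 H u v) m = 0" if "m < n"
    using that by (simp add: ext2_def assms)
  have "fps_nth (ext2 H u v) n = (\<Sum>i\<le>n. if i = n then H n (fps_nth u 0) (fps_nth v 0) else 0)"
    unfolding ext2_def fps_nth_Abs_fps by (rule sum.cong[OF refl]) (auto simp: assms)
  then show "fps_nth (ext2 H u v) n = H n (fps_nth u 0) (fps_nth v 0)" by simp
qed

lemma ext2_diff: "ext2 (\<lambda>n x y. F n x y - G n x y) u v = ext2 F u v - ext2 G u v"
  by (simp add: ext2_def fps_eq_iff sum_subtractf)

section \<open>Maps and products on \<open>A[[t]]\<close>\<close>

context hom_novikov_superalgebra
begin

lemma lin_sum: "lin f \<Longrightarrow> f (sum g S) = (\<Sum>x\<in>S. f (g x))"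
  by (induction S rule: infinite_finite_induct) (simp_all add: lin_simps)

lemma bilin_lin: "bilin scale f \<Longrightarrow> lin (f x)" "bilin scale f \<Longrightarrow> lin (\<lambda>x. f x y)"
  by (auto simp: bilin_def)

lemma ext1_diff:
  assumes "\<And>n. lin (\<phi> n)"
  shows "ext1 \<phi> (x - y) = ext1 \<phi> x - ext1 \<phi> y"
  by (simp add: ext1_def fps_eq_iff lin_simps[OF assms] sum_subtractf)

lemma A_sum: "(\<And>x. x \<in> S \<Longrightarrow> f x \<in> A i) \<Longrightarrow> sum f S \<in> A i"
  by (rule subspace_sum[OF subsp])

abbreviation fps_mul where "fps_mul \<equiv> ext2 (null_deformation mul)"

lemma fps_mul_nth: "fps_nth (fps_mul u v) n = (\<Sum>j\<le>n. mul (fps_nth u j) (fps_nth v (n - j)))"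
proof -
  have "fps_nth (fps_mul u v) n =
    (\<Sum>i\<le>n. if i = 0 then \<Sum>j\<le>n. mul (fps_nth u j) (fps_nth v (n - j)) else 0)"
    unfolding ext2_def fps_nth_Abs_fps by (rule sum.cong[OF refl]) (auto simp: null_deformation_def)
  then show ?thesis by simp
qed

lemma fps_mul_add:
  "fps_mul (u + u') v = fps_mul u v + fps_mul u' v"
  "fps_mul u (v + v') = fps_mul u v + fps_mul u v'"
  by (simp_all add: fps_eq_iff fps_mul_nth msimps sum.distrib)

lemma ext1_ext2:
  assumes "\<And>n. lin (\<phi> n)"
  shows "ext1 \<phi> (ext2 G u v) = ext2 (compose_coeffs \<phi> G) u v"
proof (rule fps_ext)
  fix n
  let ?h = "\<lambda>i l r. \<Sum>j\<le>r. \<phi> i (G l (fps_nth u j) (fps_nth v (r - j)))"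
  have "fps_nth (ext1 \<phi> (ext2 G u v)) n = (\<Sum>i\<le>n. \<Sum>l\<le>n - i. ?h i l (n - i - l))"
    by (simp add: ext1_def ext2_def lin_sum[OF assms] add.assoc)
  \<comment> \<open>Fixing the joint order p of \<open>\<phi> i\<close> and \<open>G l\<close> first
    isolates the inner sum over i that is \<open>compose_coeffs\<close> at p.\<close>
  also have "\<dots> = (\<Sum>p\<le>n. \<Sum>i\<le>p. ?h i (p - i) (n - p))"
    by (rule trans[OF sum_triples_right[where f="?h"] sum_triples_left[where f="?h", symmetric]])
  also have "\<dots> = (\<Sum>p\<le>n. \<Sum>j\<le>n - p. \<Sum>i\<le>p. \<phi> i (G (p - i) (fps_nth u j) (fps_nth v (n - p - j))))"
    by (intro sum.cong[OF refl] sum.swap)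
  also have "\<dots> = fps_nth (ext2 (compose_coeffs \<phi> G) u v) n"
    by (simp add: ext2_def compose_coeffs_def)
  finally show "fps_nth (ext1 \<phi> (ext2 G u v)) n = fps_nth (ext2 (compose_coeffs \<phi> G) u v) n" .
qed

text \<open>Both sides sum f i j k l over i + j + k + l = n. The left groups (i, j) and (k, l), as
  the product of two images under \<open>\<Phi>\<close> does; the right groups (i, k) and (j, l),
  separating the orders of the maps from those of the arguments.\<close>

lemma sum_quadruple:
  fixes f :: "nat \<Rightarrow> nat \<Rightarrow> nat \<Rightarrow> nat \<Rightarrow> 'a"
  shows "(\<Sum>q\<le>n. \<Sum>i\<le>q. \<Sum>l\<le>n - q. f i (q - i) l (n - q - l)) =
    (\<Sum>p\<le>n. \<Sum>j\<le>n - p. \<Sum>i\<le>p. f i j (p - i) (n - p - j))"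
proof -
  have "(\<Sum>q\<le>n. \<Sum>i\<le>q. \<Sum>l\<le>n - q. f i (q - i) l (n - q - l)) =
      (\<Sum>(i, j, r)\<in>triples n. \<Sum>l\<le>r. f i j l (r - l))"
    by (rule sum_triples_left)
  also have "\<dots> = (\<Sum>(i, r, j)\<in>triples n. \<Sum>l\<le>r. f i j l (r - l))"
    by (rule sum_triples_swap23)
  also have "\<dots> = (\<Sum>i\<le>n. \<Sum>r\<le>n - i. \<Sum>l\<le>r. f i (n - i - r) l (r - l))"
    by (rule sum_triples_right[symmetric])
  also have "\<dots> = (\<Sum>i\<le>n. \<Sum>l\<le>n - i. \<Sum>j\<le>n - i - l. f i j l (n - i - l - j))"
  proof (rule sum.cong[OF refl])
    fix i
    have "(\<Sum>r\<le>n - i. \<Sum>l\<le>r. f i (n - i - r) l (r - l)) = (\<Sum>(l, k, j)\<in>triples (n - i). f i j l k)"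
      by (rule sum_triples_left)
    also have "\<dots> = (\<Sum>(l, j, k)\<in>triples (n - i). f i j l k)"
      by (rule sum_triples_swap23)
    also have "\<dots> = (\<Sum>l\<le>n - i. \<Sum>j\<le>n - i - l. f i j l (n - i - l - j))"
      by (rule sum_triples_right[symmetric])
    finally show "(\<Sum>r\<le>n - i. \<Sum>l\<le>r. f i (n - i - r) l (r - l)) = \<dots>" .
  qed
  also have "\<dots> = (\<Sum>(i, l, r)\<in>triples n. \<Sum>j\<le>r. f i j l (r - j))"
    by (rule sum_triples_right)
  also have "\<dots> = (\<Sum>p\<le>n. \<Sum>i\<le>p. \<Sum>j\<le>n - p. f i j (p - i) (n - p - j))"
    by (rule sum_triples_left[symmetric])
  also have "\<dots> = (\<Sum>p\<le>n. \<Sum>j\<le>n - p. \<Sum>i\<le>p. f i j (p - i) (n - p - j))"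
    by (intro sum.cong[OF refl] sum.swap)
  finally show ?thesis .
qed

lemma fps_mul_ext1:
  "fps_mul (ext1 \<phi> u) (ext1 \<phi> v) = ext2 (product_coeffs mul \<phi>) u v"
proof (rule fps_ext)
  fix n
  have "fps_nth (fps_mul (ext1 \<phi> u) (ext1 \<phi> v)) n =
    (\<Sum>q\<le>n. \<Sum>i\<le>q. \<Sum>l\<le>n - q. mul (\<phi> i (fps_nth u (q - i))) (\<phi> l (fps_nth v (n - q - l))))"
    unfolding fps_mul_nth ext1_def fps_nth_Abs_fps lin_sum[OF mulL] lin_sum[OF mulR]
    by (intro sum.cong[OF refl] sum.swap)
  also have "\<dots> = fps_nth (ext2 (product_coeffs mul \<phi>) u v) n"
    unfolding ext2_def product_coeffs_def fps_nth_Abs_fps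
    by (rule sum_quadruple[where f="\<lambda>i j k l. mul (\<phi> i (fps_nth u j)) (\<phi> k (fps_nth v l))"])
  finally show "fps_nth (fps_mul (ext1 \<phi> u) (ext1 \<phi> v)) n = \<dots>" .
qed

lemma fps_mul_nested_nth:
  "fps_nth (fps_mul u (fps_mul v w)) n =
    (\<Sum>(i, j, k)\<in>triples n. mul (fps_nth u i) (mul (fps_nth v j) (fps_nth w k)))"
  "fps_nth (fps_mul (fps_mul u v) w) n =
    (\<Sum>(i, j, k)\<in>triples n. mul (mul (fps_nth u i) (fps_nth v j)) (fps_nth w k))"
  unfolding fps_mul_nth lin_sum[OF mulL] lin_sum[OF mulR]
  by (rule sum_triples_right sum_triples_left)+

abbreviation fps_alpha where "fps_alpha \<equiv> ext_const alpha"

text \<open>Each coefficient is a sum of values of \<open>E\<close> at coefficients of x, y, z.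
  These have the fixed degrees i, j, k, so \<open>E0\<close> kills every summand.\<close>

lemma fps_E0:
  assumes "x \<in> fps_graded A i" "y \<in> fps_graded A j" "z \<in> fps_graded A k"
  shows "fps_mul (fps_alpha x) (fps_mul y z) - sg (i * j) (fps_mul (fps_alpha y) (fps_mul x z))
    + sg (i * j) (fps_mul (fps_mul y x) (fps_alpha z))
    - sg (j * k) (fps_mul (fps_mul x z) (fps_alpha y)) = 0" (is "?L = 0")
proof (rule fps_ext)
  fix n
  \<comment> \<open>The four terms multiply x, y, z in different orders. After permuting indices,
    (p, q, r) are the orders taken from x, y, z in all of them, and the sums combine
    termwise.\<close>
  note swap12 = trans[OF fps_mul_nested_nth(1) sum_triples_swap12[symmetric]]
    trans[OF fps_mul_nested_nth(2) sum_triples_swap12[symmetric]]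
  note swap23 = trans[OF fps_mul_nested_nth(2) sum_triples_swap23[symmetric]]
  have "fps_nth ?L n = (\<Sum>(p, q, r)\<in>triples n. E i j k (fps_nth x p) (fps_nth y q) (fps_nth z r))"
    unfolding E_def fps_add_nth fps_sub_nth sg_fps_nth fps_mul_nested_nth(1)[of "fps_alpha x"]
      swap12(1)[of "fps_alpha y"] swap12(2)[of y] swap23[of x]
    by (simp add: ext_const_def case_prod_unfold sum.distrib sum_subtractf sg_sum)
  also have "\<dots> = 0"
    using assms by (intro sum.neutral) (auto simp: fps_graded_def intro!: E0)
  finally show "fps_nth ?L n = fps_nth 0 n" by simp
qed

section \<open>Even 2-cocycles and coboundaries\<close>

lemma bilin_eq_on_homogeneous:
  assumes "bilin scale f" "bilin scale g"
    and "\<And>i j x y. x \<in> A i \<Longrightarrow> y \<in> A j \<Longrightarrow> f x y = g x y"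
  shows "f x y = g x y"
proof -
  note l = lin_add[OF bilin_lin(1)] lin_add[OF bilin_lin(2)]
  have "f (gcomp A 0 x + gcomp A 1 x) (gcomp A 0 y + gcomp A 1 y)
    = g (gcomp A 0 x + gcomp A 1 x) (gcomp A 0 y + gcomp A 1 y)"
    by (simp add: l[OF assms(1)] l[OF assms(2)] assms(3)[OF gcomp_in gcomp_in])
  then show ?thesis by (simp add: gcomp_sum)
qed

lemma hcomp2_even:
  assumes "bilin scale f" "even_map2 A f"
  shows "hcomp2 A d f = (if d = 0 then f else (\<lambda>x y. 0))"
proof (intro ext)
  fix x y
  note l = lin_add[OF bilin_lin(1)[OF assms(1)]] lin_add[OF bilin_lin(2)[OF assms(1)]]
  have *: "f (gcomp A i x) (gcomp A j y) \<in> A (i + j)" for i j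
    using assms(2) by (simp add: even_map2_def)
  have "f (gcomp A 0 x + gcomp A 1 x) (gcomp A 0 y + gcomp A 1 y) =
    (\<Sum>i\<in>{0,1}. \<Sum>j\<in>{0,1}. f (gcomp A i x) (gcomp A j y))"
    by (simp add: l algebra_simps)
  moreover have "gcomp A (i + j + d) (f (gcomp A i x) (gcomp A j y)) =
      (if d = 0 then f (gcomp A i x) (gcomp A j y) else 0)" for i j
    using gcomp_hom[OF *, of "i + j + d" i j] by (simp only: add_cancel_left_right)
  ultimately show "hcomp2 A d f x y = (if d = 0 then f else (\<lambda>x y. 0)) x y"
    unfolding hcomp2_def by (simp add: gcomp_sum)
qed

text \<open>Only the summand d = 0 of \<open>delta2\<close> sees an even f; for d = 1 the formula is
  applied to the zero map.\<close>

lemma even_cocycleI: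
  assumes "f \<in> C2 scale alpha" "even_map2 A f"
    and "\<And>i j k x y z. x \<in> A i \<Longrightarrow> y \<in> A j \<Longrightarrow> z \<in> A k \<Longrightarrow> delta2_hom mul alpha 0 f i j k x y z = 0"
  shows "f \<in> Z2_cocycles scale A mul alpha"
proof -
  have f: "bilin scale f" using assms(1) by (simp add: C2_def)
  have "delta2_hom mul alpha 1 (\<lambda>x y. 0) i j k x y z = 0" for i j k x y z
    by (simp add: delta2_hom_def msimps)
  then have "delta2 A mul alpha f x y z = 0" for x y z
    unfolding delta2_def hcomp2_even[OF f assms(2)] by (simp add: assms(3)[OF gcomp_in gcomp_in gcomp_in])
  then show ?thesis using assms(1) by (simp add: Z2_cocycles_def fun_eq_iff)
qed

lemma zero_coboundary: "(\<lambda>x y. 0) \<in> B2_coboundaries scale A mul alpha"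
proof -
  have "(\<lambda>x. 0) \<in> C1 scale alpha"
    by (auto simp: C1_def msimps intro: linI)
  moreover have "delta1 A mul (\<lambda>x. 0) = (\<lambda>x y. 0)"
    by (simp add: delta1_def delta1_hom_def hcomp1_def gcomp_0 msimps fun_eq_iff)
  ultimately show ?thesis unfolding B2_coboundaries_def by (metis image_eqI)
qed

text \<open>The class of f is an element of the quotient, so it equals
  \<open>B2_coboundaries\<close>; f lies in its own class because the zero map is a
  coboundary.\<close>

lemma cocycle_coboundary:
  assumes H: "H2_cohomology scale A mul alpha = {B2_coboundaries scale A mul alpha}"
    and f: "f \<in> Z2_cocycles scale A mul alpha"
  shows "f \<in> B2_coboundaries scale A mul alpha"
proof -
  let ?r = "{(f, g). f \<in> Z2_cocycles scale A mul alpha \<and> g \<in> Z2_cocycles scale A mul alpha \<and>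
        (\<lambda>x y. f x y - g x y) \<in> B2_coboundaries scale A mul alpha}"
  have "?r `` {f} \<in> H2_cohomology scale A mul alpha"
    unfolding H2_cohomology_def by (rule quotientI[OF f])
  then have "?r `` {f} = B2_coboundaries scale A mul alpha" using H by blast
  moreover have "f \<in> ?r `` {f}" using f zero_coboundary by simp
  ultimately show ?thesis by blast
qed

text \<open>By \<open>hcomp2_delta1\<close>, taking degree 0 components commutes with
  \<open>\<delta>\<^sup>1\<close>. This yields the formula for the degree 0 component h of f on
  homogeneous arguments, and bilinearity extends it to all.\<close>

lemma even_cocycle_cobounded:
  assumes H: "H2_cohomology scale A mul alpha = {B2_coboundaries scale A mul alpha}"
    and c: "c \<in> Z2_cocycles scale A mul alpha" "even_map2 A c"
  obtains h where "lin h" "even_map A h" "\<And>x. h (alpha x) = alpha (h x)"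
    "\<And>x y. c x y = mul x (h y) + mul (h x) y - h (mul x y)"
proof -
  obtain f where f: "f \<in> C1 scale alpha" "c = delta1 A mul f"
    using cocycle_coboundary[OF H c(1)] by (auto simp: B2_coboundaries_def)
  have l: "lin f" using f by (simp add: C1_def)
  define h where "h = hcomp1 A 0 f"
  have lh: "lin h" unfolding h_def by (rule hcomp1_lin[OF l])
  have eh: "even_map A h" unfolding even_map_def h_def
    using hcomp1_in[OF _ l, where d=0] by (metis add_0_right)
  have bc: "bilin scale c" using c(1) by (simp add: Z2_cocycles_def C2_def)
  have bd: "bilin scale (\<lambda>x y. mul x (h y) + mul (h x) y - h (mul x y))"
    unfolding bilin_def
    by (intro conjI allI linI) (simp_all add: msimps lin_simps[OF lh] algebra_simps scale_right_distrib)
  have "c x y = mul x (h y) + mul (h x) y - h (mul x y)" if "x \<in> A i" "y \<in> A j" for i j x y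
    using hcomp2_delta1[OF f(1) that, of 0] hcomp2_even[OF bc c(2), of 0] f(2)
    by (simp add: delta1_hom_def sg_def h_def)
  from bilin_eq_on_homogeneous[OF bc bd this]
  show ?thesis using that[OF lh eh] hcomp1_alpha[OF f(1)] by (simp add: h_def)
qed

section \<open>Invertibility of formal maps with constant term the identity\<close>

lemma bij_ext1:
  assumes lin: "\<And>n. lin (\<phi> n)" and id: "\<phi> 0 = id"
  shows "bij (ext1 \<phi>)"
proof (rule bijI)
  \<comment> \<open>The system is triangular: coefficient n of the image is that of x plus terms in
    strictly earlier ones. Hence injectivity by strong induction and a preimage by
    recursion.\<close>
  have nth: "fps_nth (ext1 \<phi> x) n = fps_nth x n + (\<Sum>i=1..n. \<phi> i (fps_nth x (n - i)))" for x n
  proof -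
    have "{..n} = insert 0 {1..n}" by auto
    then show ?thesis by (simp add: ext1_def id)
  qed
  show "inj (ext1 \<phi>)"
  proof (rule injI)
    fix x y assume "ext1 \<phi> x = ext1 \<phi> y"
    then have z: "fps_nth (ext1 \<phi> (x - y)) n = 0" for n by (simp add: ext1_diff[OF lin])
    have "fps_nth (x - y) n = 0" for n
    proof (induction n rule: less_induct)
      case (less n)
      then have "(\<Sum>i=1..n. \<phi> i (fps_nth (x - y) (n - i))) = 0"
        by (intro sum.neutral) (auto simp del: fps_sub_nth simp: lin_0[OF lin])
      then show ?case using z[of n] unfolding nth by simp
    qed
    then show "x = y" by (simp add: fps_eq_iff)
  qed
  show "surj (ext1 \<phi>)"
  proof (rule surjI)
    fix y
    have "\<exists>f. \<forall>n. f n = fps_nth y n - (\<Sum>i=1..n. \<phi> i (f (n - i)))"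
      by (rule dependent_wellorder_choice[where
            P="\<lambda>f n r. r = fps_nth y n - (\<Sum>i=1..n. \<phi> i (f (n - i)))"]) (simp, rule exI, rule refl)
    then obtain f where f: "\<And>n. f n = fps_nth y n - (\<Sum>i=1..n. \<phi> i (f (n - i)))" by blast
    have "f n + (\<Sum>i=1..n. \<phi> i (f (n - i))) = fps_nth y n" for n
      using f[of n] by (simp only: eq_diff_eq)
    then have "ext1 \<phi> (Abs_fps f) = y"
      by (simp add: fps_eq_iff nth)
    then show "ext1 \<phi> (SOME x. ext1 \<phi> x = y) = y" by (rule someI)
  qed
qed

end

section \<open>Deformations and their obstruction cocycles\<close>

locale deformed_hom_novikov = hom_novikov_superalgebra +
  fixes G
  assumes deformation: "formal_deformation scale A mul alpha G"
begin

lemma G_bilin: "bilin scale (G n)" and G_even: "even_map2 A (G n)" and G_zero: "G 0 = mul"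
  using deformation by (auto simp: formal_deformation_def)

lemma G_lin: "lin (G n x)" "lin (\<lambda>x. G n x y)"
  by (rule bilin_lin[OF G_bilin])+

lemma G_alpha: "G n (alpha x) (alpha y) = alpha (G n x y)"
proof -
  have "ext2 G (fps_alpha (fps_const x)) (fps_alpha (fps_const y)) = fps_alpha (ext2 G (fps_const x) (fps_const y))"
    using deformation by (simp add: formal_deformation_def Let_def)
  moreover have "fps_alpha (fps_const w) = fps_const (alpha w)" for w
    by (simp add: ext_const_def fps_eq_iff msimps)
  ultimately show ?thesis
    using ext2_const_nth[of G, OF lin_0[OF G_lin(2)] lin_0[OF G_lin(1)]]
    by (metis ext_const_def fps_nth_Abs_fps)
qed

text \<open>This is \<open>E\<close> with \<open>ext2 G\<close> for \<open>mul\<close>, obtained by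
  substituting the second deformation identity into the first.\<close>

lemma deformation_E0:
  assumes "x \<in> fps_graded A i" "y \<in> fps_graded A j" "z \<in> fps_graded A k"
  shows "ext2 G (fps_alpha x) (ext2 G y z) - sg (i * j) (ext2 G (fps_alpha y) (ext2 G x z))
    + sg (i * j) (ext2 G (ext2 G y x) (fps_alpha z))
    - sg (j * k) (ext2 G (ext2 G x z) (fps_alpha y)) = 0"
proof -
  have "ext2 G (fps_alpha x) (ext2 G y z) - ext2 G (ext2 G x y) (fps_alpha z) =
      sg (i * j) (ext2 G (fps_alpha y) (ext2 G x z) - ext2 G (ext2 G y x) (fps_alpha z))"
    "ext2 G (ext2 G x y) (fps_alpha z) = sg (j * k) (ext2 G (ext2 G x z) (fps_alpha y))"
    using deformation assms unfolding formal_deformation_def Let_def by blast+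
  moreover have "a - sg p c + sg p d - sg q e = 0"
    if "a - b = sg p (c - d)" "b = sg q e" for a b c d e :: "'b fps" and p q
    using that by (auto simp: sg_def algebra_simps split: if_splits)
  ultimately show ?thesis by blast
qed

definition obstruction where
  "obstruction \<phi> n x y = compose_coeffs \<phi> G n x y - product_coeffs mul \<phi> n x y"

text \<open>Evenness is included so that \<open>\<Phi>\<close> preserves the degree of homogeneous
  series and the obstruction is an even cochain.\<close>

definition admissible where
  "admissible f \<longleftrightarrow> lin f \<and> even_map A f \<and> (\<forall>x. f (alpha x) = alpha (f x))"

lemma obstruction_C2:
  assumes "\<And>k. admissible (\<phi> k)"
  shows "obstruction \<phi> n \<in> C2 scale alpha" "even_map2 A (obstruction \<phi> n)"
proof -
  have l: "lin (\<phi> k)" and al: "\<phi> k (alpha x) = alpha (\<phi> k x)" for k x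
    using assms by (simp_all add: admissible_def)
  have ev: "\<phi> k x \<in> A i" if "x \<in> A i" for k x i
    using assms that by (auto simp: admissible_def even_map_def)
  note simps = lin_simps[OF l] msimps lin_simps[OF G_lin(1)] lin_simps[OF G_lin(2)]
  have "bilin scale (obstruction \<phi> n)"
    unfolding bilin_def
    by (intro conjI allI linI)
      (simp_all add: obstruction_def compose_coeffs_def product_coeffs_def simps sum.distrib
        scale_right_diff_distrib scale_sum_right)
  moreover have "alpha (obstruction \<phi> n x y) = obstruction \<phi> n (alpha x) (alpha y)" for x y
    by (simp add: obstruction_def compose_coeffs_def product_coeffs_def simps lin_sum[OF alpha_linear]
        al G_alpha alpha_mul)
  ultimately show "obstruction \<phi> n \<in> C2 scale alpha" by (simp add: C2_def)
  show "even_map2 A (obstruction \<phi> n)"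
    unfolding even_map2_def
  proof (intro allI ballI)
    fix i j x y assume "x \<in> A i" "y \<in> A j"
    then show "obstruction \<phi> n x y \<in> A (i + j)"
      unfolding obstruction_def compose_coeffs_def product_coeffs_def
      using G_even by (intro A_closed(3) A_sum ev mul_in) (auto simp only: even_map2_def)
  qed
qed

lemma obstruction_cocycle:
  assumes adm: "\<And>k. admissible (\<phi> k)" and id: "\<phi> 0 = id"
    and vanish: "\<And>m x y. m < n \<Longrightarrow> obstruction \<phi> m x y = 0"
  shows "obstruction \<phi> n \<in> Z2_cocycles scale A mul alpha"
proof (rule even_cocycleI)
  show "obstruction \<phi> n \<in> C2 scale alpha" "even_map2 A (obstruction \<phi> n)"
    using obstruction_C2[OF adm] .
next
  fix i j k x0 y0 z0
  assume hom: "x0 \<in> A i" "y0 \<in> A j" "z0 \<in> A k"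
  have l: "\<And>k. lin (\<phi> k)" using adm by (simp add: admissible_def)
  let ?g = "ext2 G" and ?\<Phi> = "ext1 \<phi>" and ?D = "ext2 (obstruction \<phi>)" and ?c = "obstruction \<phi> n"
  \<comment> \<open>\<open>?D\<close> is the failure of \<open>\<Phi>\<close> to be multiplicative.
    By \<open>vanish\<close> it starts in order n, so a factor multiplied with it contributes only
    its constant term there.\<close>
  have D: "?\<Phi> (?g u v) = fps_mul (?\<Phi> u) (?\<Phi> v) + ?D u v" for u v
    unfolding obstruction_def ext2_diff by (simp add: ext1_ext2[OF l] fps_mul_ext1)
  have Dn: "fps_nth (?D u v) n = ?c (fps_nth u 0) (fps_nth v 0)"
    and Dm: "m < n \<Longrightarrow> fps_nth (?D u v) m = 0" for u v m
    using ext2_lowest[where H="obstruction \<phi>", OF vanish] by blast+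
  have \<Phi>0: "fps_nth (?\<Phi> u) 0 = fps_nth u 0" and g0: "fps_nth (?g u v) 0 = mul (fps_nth u 0) (fps_nth v 0)"
    and \<alpha>n: "fps_nth (fps_alpha u) m = alpha (fps_nth u m)" for u v m
    by (simp_all add: ext1_def id ext2_def G_zero ext_const_def)
  have \<Phi>\<alpha>: "?\<Phi> (fps_alpha u) = fps_alpha (?\<Phi> u)" for u
    using adm by (simp add: ext1_def ext_const_def fps_eq_iff lin_sum[OF alpha_linear] admissible_def)
  have mulD: "fps_nth (fps_mul u (?D v w)) n = mul (fps_nth u 0) (?c (fps_nth v 0) (fps_nth w 0))" for u v w
  proof -
    have "fps_nth (fps_mul u (?D v w)) n =
      (\<Sum>m\<le>n. if m = 0 then mul (fps_nth u 0) (?c (fps_nth v 0) (fps_nth w 0)) else 0)"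
      unfolding fps_mul_nth by (intro sum.cong) (auto simp: Dn Dm msimps)
    then show ?thesis by simp
  qed
  have Dmul: "fps_nth (fps_mul (?D v w) u) n = mul (?c (fps_nth v 0) (fps_nth w 0)) (fps_nth u 0)" for u v w
  proof -
    have "fps_nth (fps_mul (?D v w) u) n =
      (\<Sum>m\<le>n. if m = n then mul (?c (fps_nth v 0) (fps_nth w 0)) (fps_nth u 0) else 0)"
      unfolding fps_mul_nth by (intro sum.cong) (auto simp: Dn Dm msimps)
    then show ?thesis by simp
  qed
  \<comment> \<open>Moving \<open>\<Phi>\<close> through two nested products uses \<open>D\<close>
    twice, giving one term from the inner error and one from the outer. \<open>\<Phi>\<close>
    disappears from both because \<open>\<phi> 0 = id\<close>.\<close>
  have right: "fps_nth (?\<Phi> (?g (fps_alpha u) (?g v w))) n =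
      fps_nth (fps_mul (fps_alpha (?\<Phi> u)) (fps_mul (?\<Phi> v) (?\<Phi> w))) n
      + mul (alpha (fps_nth u 0)) (?c (fps_nth v 0) (fps_nth w 0))
      + ?c (alpha (fps_nth u 0)) (mul (fps_nth v 0) (fps_nth w 0))"
    and left: "fps_nth (?\<Phi> (?g (?g u v) (fps_alpha w))) n =
      fps_nth (fps_mul (fps_mul (?\<Phi> u) (?\<Phi> v)) (fps_alpha (?\<Phi> w))) n
      + mul (?c (fps_nth u 0) (fps_nth v 0)) (alpha (fps_nth w 0))
      + ?c (mul (fps_nth u 0) (fps_nth v 0)) (alpha (fps_nth w 0))" for u v w
    by (simp_all add: D fps_mul_add \<Phi>\<alpha> mulD Dmul Dn g0 \<Phi>0 \<alpha>n)
  define x y z where "x = fps_const x0" "y = fps_const y0" "z = fps_const z0"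
  have gr: "x \<in> fps_graded A i" "y \<in> fps_graded A j" "z \<in> fps_graded A k"
    using hom by (auto simp: fps_graded_def x_y_z_def)
  have gr\<Phi>: "?\<Phi> u \<in> fps_graded A i" if "u \<in> fps_graded A i" for u i
    using that adm by (auto simp: fps_graded_def ext1_def admissible_def even_map_def intro!: A_sum)
  have nth0: "fps_nth x 0 = x0" "fps_nth y 0 = y0" "fps_nth z 0 = z0"
    by (simp_all add: x_y_z_def)
  have \<Phi>add: "?\<Phi> (u + v) = ?\<Phi> u + ?\<Phi> v" and \<Phi>sg: "?\<Phi> (sg s u) = sg s (?\<Phi> u)" for u v s
    by (simp_all add: fps_eq_iff ext1_def sg_def lin_simps[OF l] sum.distrib sum_negf)
  have \<Phi>0': "?\<Phi> 0 = 0" by (simp add: fps_eq_iff ext1_def lin_0[OF l])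
  have 1: "fps_nth (?\<Phi> (?g (fps_alpha x) (?g y z))) n - sg (i * j) (fps_nth (?\<Phi> (?g (fps_alpha y) (?g x z))) n)
    + sg (i * j) (fps_nth (?\<Phi> (?g (?g y x) (fps_alpha z))) n)
    - sg (j * k) (fps_nth (?\<Phi> (?g (?g x z) (fps_alpha y))) n) = 0" (is "?deformed = 0")
    using arg_cong[OF deformation_E0[OF gr], of "\<lambda>w. fps_nth (?\<Phi> w) n"]
    by (simp add: ext1_diff[OF l] \<Phi>add \<Phi>sg sg_fps_nth \<Phi>0')
  have 2: "fps_nth (fps_mul (fps_alpha (?\<Phi> x)) (fps_mul (?\<Phi> y) (?\<Phi> z))) n
    - sg (i * j) (fps_nth (fps_mul (fps_alpha (?\<Phi> y)) (fps_mul (?\<Phi> x) (?\<Phi> z))) n)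
    + sg (i * j) (fps_nth (fps_mul (fps_mul (?\<Phi> y) (?\<Phi> x)) (fps_alpha (?\<Phi> z))) n)
    - sg (j * k) (fps_nth (fps_mul (fps_mul (?\<Phi> x) (?\<Phi> z)) (fps_alpha (?\<Phi> y))) n) = 0"
    (is "?undeformed = 0")
    using arg_cong[OF fps_E0[OF gr[THEN gr\<Phi>]], of "\<lambda>w. fps_nth w n"]
    by (simp add: sg_fps_nth)
  have sga: "sg s (a + b) = sg s a + sg s b" for s and a b :: 'b by (simp add: sg_def)
  \<comment> \<open>The four terms of \<open>E\<close> give eight error terms: exactly the summands
    of \<open>delta2_hom\<close> at d = 0, where the signs involving d are trivial.\<close>
  have "sg 0 a = a" for a :: 'b by (simp add: sg_def)
  then have "delta2_hom mul alpha 0 ?c i j k x0 y0 z0 = ?deformed - ?undeformed"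
    unfolding left right nth0 sga delta2_hom_def by (simp add: algebra_simps)
  then show "delta2_hom mul alpha 0 ?c i j k x0 y0 z0 = 0" by (simp only: 1 2 diff_self)
qed

section \<open>Construction of the equivalence, one order at a time\<close>

lemma trivializing_step:
  assumes H: "H2_cohomology scale A mul alpha = {B2_coboundaries scale A mul alpha}"
    and prev: "\<And>m. m < n \<Longrightarrow> admissible (\<phi> m) \<and> (m = 0 \<longrightarrow> \<phi> m = id) \<and> (\<forall>x y. obstruction \<phi> m x y = 0)"
  shows "\<exists>h. admissible h \<and> (n = 0 \<longrightarrow> h = id) \<and> (\<forall>x y. obstruction (\<phi>(n := h)) n x y = 0)"
proof (cases "n = 0")
  case True
  have "admissible id" by (auto simp: admissible_def even_map_def intro: linI)
  then show ?thesis using True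
    by (auto simp: obstruction_def compose_coeffs_def product_coeffs_def G_zero)
next
  case False
  \<comment> \<open>Zero from order n on keeps every coefficient admissible and the earlier
    obstructions unchanged; the obstruction at n is then the defect that h has to cancel.\<close>
  define \<psi> where "\<psi> = (\<lambda>k. if k < n then \<phi> k else (\<lambda>x. 0))"
  have "admissible (\<psi> k)" for k
    using prev by (auto simp: \<psi>_def admissible_def even_map_def msimps intro: linI)
  moreover have "\<psi> 0 = id" using False prev by (simp add: \<psi>_def)
  moreover have "obstruction \<psi> m x y = 0" if "m < n" for m x y
  proof -
    have "obstruction \<psi> m x y = obstruction \<phi> m x y"
      using that by (simp add: obstruction_def compose_coeffs_def product_coeffs_def \<psi>_def
          less_imp_diff_less)
    then show ?thesis using prev that by simp
  qed
  ultimately obtain h where h: "lin h" "even_map A h" "\<And>x. h (alpha x) = alpha (h x)"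
    "\<And>x y. obstruction \<psi> n x y = mul x (h y) + mul (h x) y - h (mul x y)"
    using even_cocycle_cobounded[OF H obstruction_cocycle obstruction_C2(2)] by metis
  obtain n' where n: "n = Suc n'" using False not0_implies_Suc by blast
  have "obstruction (\<phi>(n := h)) n x y = 0" for x y
  proof -
    \<comment> \<open>Replacing the zero at n by h adds \<open>h (mul x y)\<close> to the composite,
      since \<open>G 0 = mul\<close>. To the product it adds the terms i = 0 and i = n, which are
      distinct as n > 0. The net change is minus \<open>\<delta>\<^sup>1 h\<close>.\<close>
    let ?\<chi> = "\<phi>(n := h)"
    have c: "compose_coeffs ?\<chi> G n x y = compose_coeffs \<psi> G n x y + h (mul x y)"
      by (simp add: compose_coeffs_def n \<psi>_def G_zero)
    have "product_coeffs mul ?\<chi> n x y = product_coeffs mul \<psi> n x y + mul x (h y) + mul (h x) y"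
    proof -
      have "product_coeffs mul ?\<chi> n x y - product_coeffs mul \<psi> n x y =
        (\<Sum>i\<le>n. (if i = 0 then mul x (h y) else 0) + (if i = n then mul (h x) y else 0))"
        unfolding product_coeffs_def sum_subtractf[symmetric]
        using False prev by (intro sum.cong) (auto simp: \<psi>_def msimps)
      then show ?thesis by (simp add: sum.distrib algebra_simps)
    qed
    with c h(4)[of x y] show ?thesis by (simp add: obstruction_def algebra_simps)
  qed
  then show ?thesis using h(1-3) False by (auto simp: admissible_def)
qed

lemma deformation_trivial:
  assumes H: "H2_cohomology scale A mul alpha = {B2_coboundaries scale A mul alpha}"
  shows "trivial_deformation scale mul alpha G"
proof -
  \<comment> \<open>The update at n makes the condition depend on \<open>\<phi>\<close> only below
    n, as the recursive choice requires. At h = \<open>\<phi> n\<close> the update is void, so the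
    obstruction of the chosen family vanishes in every order.\<close>
  let ?P = "\<lambda>\<phi> n h. admissible h \<and> (n = 0 \<longrightarrow> h = id) \<and> (\<forall>x y. obstruction (\<phi>(n := h)) n x y = 0)"
  have "\<exists>\<phi>. \<forall>n. ?P \<phi> n (\<phi> n)"
  proof (rule dependent_wellorder_choice)
    fix \<phi> \<chi> :: "nat \<Rightarrow> 'b \<Rightarrow> 'b" and n h
    assume "\<And>m. m < n \<Longrightarrow> \<phi> m = \<chi> m"
    then have "obstruction (\<phi>(n := h)) n = obstruction (\<chi>(n := h)) n"
      by (auto simp: fun_eq_iff obstruction_def compose_coeffs_def product_coeffs_def
          intro!: arg_cong2[where f="(-)"] sum.cong)
    then show "?P \<phi> n h = ?P \<chi> n h" by simp
  next
    fix n and \<phi> :: "nat \<Rightarrow> 'b \<Rightarrow> 'b"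
    assume "\<And>m. m < n \<Longrightarrow> ?P \<phi> m (\<phi> m)"
    then show "\<exists>h. ?P \<phi> n h" by (intro trivializing_step[OF H]) auto
  qed
  then obtain \<phi> where \<phi>: "\<And>n. admissible (\<phi> n)" "\<phi> 0 = id" "\<And>n x y. obstruction \<phi> n x y = 0"
    by auto
  have l: "\<And>n. lin (\<phi> n)" using \<phi>(1) by (simp add: admissible_def)
  have commutes: "ext1 \<phi> \<circ> fps_alpha = fps_alpha \<circ> ext1 \<phi>"
    using \<phi>(1) by (simp add: fun_eq_iff ext1_def ext_const_def fps_eq_iff lin_sum[OF alpha_linear] admissible_def)
  have multiplicative: "ext1 \<phi> (ext2 G x y) = fps_mul (ext1 \<phi> x) (ext1 \<phi> y)" for x y
  proof -
    have "compose_coeffs \<phi> G = product_coeffs mul \<phi>"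
      using \<phi>(3) by (simp add: fun_eq_iff obstruction_def)
    then show ?thesis by (simp add: ext1_ext2[OF l] fps_mul_ext1)
  qed
  show ?thesis
    unfolding trivial_deformation_def equivalent_deformations_def
    by (intro exI[of _ \<phi>] conjI allI l \<phi>(2) module_hom_ext1 bij_ext1 commutes multiplicative)
qed

end

theorem theorem4p9:
  fixes scale :: "'f::field \<Rightarrow> 'a::ab_group_add \<Rightarrow> 'a"
    and A :: "bit \<Rightarrow> 'a set" and mul :: "'a \<Rightarrow> 'a \<Rightarrow> 'a" and alpha :: "'a \<Rightarrow> 'a"
  assumes "hom_novikov_superalgebra scale A mul alpha"
    and "H2_cohomology scale A mul alpha = {B2_coboundaries scale A mul alpha}"
  shows "analytically_rigid scale A mul alpha"
  unfolding analytically_rigid_def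
proof (intro allI impI)
  fix G assume "formal_deformation scale A mul alpha G"
  then interpret deformed_hom_novikov scale A mul alpha G
    using assms(1) by (simp add: deformed_hom_novikov_def deformed_hom_novikov_axioms_def)
  show "trivial_deformation scale mul alpha G" by (rule deformation_trivial[OF assms(2)])
qed

end
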